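(* Let $r \in \mathbb{Q}_{>0}$ be such that, writing $r = a/b$ with $a, b$ positive integers and $\gcd(a,b) = 1$, one has $a > 1$ and $b > 1$. Let $M = \langle r^n \mid n \in \mathbb{Z} \rangle$ be the additive submonoid of $\mathbb{Q}_{\ge 0}$ generated by all integer powers of $r$. Then the group $\mathrm{Aut}(M)$ of monoid automorphisms of $M$ is isomorphic to $\mathbb{Z}$.
   Context: For a subset $S$ of an additive monoid, $\langle S \rangle$ denotes the smallest submonoid containing $S$. $\mathrm{Aut}(M)$ is the group, under composition, of bijective monoid homomorphisms $M \to M$. *)

theory Defs
  imports Complex_Main "HOL-Algebra.Algebra"
begin

definition submonoid_generated :: "('a, 'b) monoid_scheme \<Rightarrow> 'a set \<Rightarrow> 'a set"
  where "submonoid_generated G S = \<Inter> {H. submonoid H G \<and> S \<subseteq> H}"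

lemma submonoid_generated_submonoid:
  assumes "monoid G" "S \<subseteq> carrier G"
  shows "submonoid (submonoid_generated G S) G"
proof -
  have "submonoid (carrier G) G"
    using assms(1) by (simp add: submonoid_def monoid.m_closed monoid.one_closed)
  with assms(2) have "carrier G \<in> {H. submonoid H G \<and> S \<subseteq> H}"
    by simp
  then have "submonoid_generated G S \<subseteq> carrier G"
    unfolding submonoid_generated_def by (rule Inter_lower)
  then show ?thesis
    by (auto simp: submonoid_generated_def intro!: submonoid.intro
        dest: submonoid.m_closed submonoid.one_closed)
qed

lemma submonoid_generated_superset: "S \<subseteq> submonoid_generated G S"
  by (auto simp: submonoid_generated_def)

lemma submonoid_generated_least:
  "submonoid H G \<Longrightarrow> S \<subseteq> H \<Longrightarrow> submonoid_generated G S \<subseteq> H"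
  by (auto simp: submonoid_generated_def)

(* HOL-Algebra structures are written multiplicatively: the "product" here is addition. *)
definition nonneg_rat_monoid :: "rat monoid"
  where "nonneg_rat_monoid = \<lparr>carrier = {q. 0 \<le> q}, monoid.mult = (+), one = 0\<rparr>"

lemma monoid_nonneg_rat_monoid: "monoid nonneg_rat_monoid"
  by (rule monoidI) (auto simp: nonneg_rat_monoid_def)

definition power_monoid :: "rat \<Rightarrow> rat monoid"
  where "power_monoid r = nonneg_rat_monoid
    \<lparr>carrier := submonoid_generated nonneg_rat_monoid {r powi n | n :: int. True}\<rparr>"

lemma monoid_power_monoid:
  assumes "r > 0"
  shows "monoid (power_monoid r)"
proof -
  have "{r powi n | n :: int. True} \<subseteq> carrier nonneg_rat_monoid"
    using assms by (auto simp: nonneg_rat_monoid_def)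
  from submonoid_generated_submonoid[OF monoid_nonneg_rat_monoid this]
  show ?thesis
    unfolding power_monoid_def
    using monoid_nonneg_rat_monoid by (rule submonoid.submonoid_is_monoid)
qed

(* hom only demands compatibility with the product, so preservation of the unit is
   required separately; Bij consists of the bijections that are extensional, i.e.
   undefined outside the carrier, so that each automorphism is counted once. *)
definition monoid_auto :: "('a, 'b) monoid_scheme \<Rightarrow> ('a \<Rightarrow> 'a) set"
  where "monoid_auto M = {f \<in> hom M M \<inter> Bij (carrier M). f \<one>\<^bsub>M\<^esub> = \<one>\<^bsub>M\<^esub>}"

definition monoid_AutGroup :: "('a, 'b) monoid_scheme \<Rightarrow> ('a \<Rightarrow> 'a) monoid"
  where "monoid_AutGroup M = BijGroup (carrier M) \<lparr>carrier := monoid_auto M\<rparr>"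

lemma group_monoid_AutGroup:
  assumes "monoid M"
  shows "group (monoid_AutGroup M)"
proof -
  interpret monoid M by fact
  have "subgroup (monoid_auto M) (BijGroup (carrier M))"
  proof (rule subgroup.intro)
    show "monoid_auto M \<subseteq> carrier (BijGroup (carrier M))"
      by (auto simp: monoid_auto_def BijGroup_def)
  next
    fix f g
    assume "f \<in> monoid_auto M" "g \<in> monoid_auto M"
    then have B: "f \<in> Bij (carrier M)" "g \<in> Bij (carrier M)"
      and h: "f \<in> hom M M" "g \<in> hom M M"
      and o: "f \<one>\<^bsub>M\<^esub> = \<one>\<^bsub>M\<^esub>" "g \<one>\<^bsub>M\<^esub> = \<one>\<^bsub>M\<^esub>"
      by (auto simp: monoid_auto_def)
    have "compose (carrier M) f g \<in> hom M M"
      using h by (auto simp: hom_def compose_def Pi_iff)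
    moreover have "compose (carrier M) f g \<one>\<^bsub>M\<^esub> = \<one>\<^bsub>M\<^esub>"
      using o by (simp add: compose_def)
    ultimately show "f \<otimes>\<^bsub>BijGroup (carrier M)\<^esub> g \<in> monoid_auto M"
      using B by (simp add: monoid_auto_def BijGroup_def compose_Bij)
  next
    show "\<one>\<^bsub>BijGroup (carrier M)\<^esub> \<in> monoid_auto M"
      by (auto simp: monoid_auto_def BijGroup_def id_Bij hom_def)
  next
    fix f
    assume f: "f \<in> monoid_auto M"
    then have B: "f \<in> Bij (carrier M)" and h: "f \<in> hom M M" and o: "f \<one>\<^bsub>M\<^esub> = \<one>\<^bsub>M\<^esub>"
      by (auto simp: monoid_auto_def)
    have i: "inv_into (carrier M) f x \<in> carrier M" if "x \<in> carrier M" for x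
      using B that by (rule Bij_inv_into_mem)
    have m: "inv_into (carrier M) f (x \<otimes>\<^bsub>M\<^esub> y)
        = inv_into (carrier M) f x \<otimes>\<^bsub>M\<^esub> inv_into (carrier M) f y"
      if "x \<in> carrier M" "y \<in> carrier M" for x y
      using h B that by (intro Bij_inv_into_lemma) (auto simp: hom_def)
    have "inj_on f (carrier M)"
      using B by (simp add: Bij_def bij_betw_def)
    from inv_into_f_f[OF this one_closed] o
    have "inv_into (carrier M) f \<one>\<^bsub>M\<^esub> = \<one>\<^bsub>M\<^esub>" by simp
    then have "restrict (inv_into (carrier M) f) (carrier M) \<in> monoid_auto M"
      using restrict_inv_into_Bij[OF B] i m by (simp add: monoid_auto_def hom_def)
    then show "inv\<^bsub>BijGroup (carrier M)\<^esub> f \<in> monoid_auto M"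
      by (simp only: inv_BijGroup[OF B])
  qed
  then show ?thesis
    unfolding monoid_AutGroup_def
    by (rule subgroup.subgroup_is_group) (rule group_BijGroup)
qed

end

theory Submission
  imports Defs
begin

text \<open>
  Let \<open>M\<close> be the monoid generated by the powers of \<open>r\<close>. Every additive map from \<open>M\<close> to \<open>\<rat>\<close>
  is multiplication by a constant, because any \<open>x = m / n\<close> in \<open>M\<close> satisfies \<open>n x = m \<cdot> 1\<close>. So an
  automorphism \<open>f\<close> is determined by \<open>f 1\<close>. The multiplications by powers of \<open>r\<close> are automorphisms
  since they permute the generators, and they are pairwise distinct because \<open>r \<noteq> 1\<close>, so they
  form a copy of \<open>\<int>\<close>. The content of the theorem is that there are no other automorphisms, that
  is, that \<open>f 1\<close> has to be a power of \<open>r\<close> (\<open>monoid_auto_is_dilation\<close>).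

  This holds because \<open>1\<close> is an atom of \<open>M\<close>: it is not a sum of two nonzero elements
  (\<open>one_atom\<close>). Indeed, replacing \<open>r\<close> by its inverse leaves \<open>M\<close> unchanged, so let
  \<open>r = a / b < 1\<close>. If \<open>1 = x + y\<close> with \<open>x\<close>, \<open>y\<close> nonzero, then \<open>x\<close> and \<open>y\<close> are both less than
  \<open>1\<close>, so only positive powers of \<open>r\<close> occur in them and their numerators are divisible by
  \<open>a\<close>, while their denominators are powers of \<open>b\<close>. Adding up, \<open>a\<close> divides a power of \<open>b\<close>,
  against coprimality. Now write the nonzero element \<open>f 1\<close> as \<open>r\<^sup>k + y\<close> with \<open>y\<close> in \<open>M\<close>; applying
  the inverse of \<open>f\<close> splits \<open>1\<close> into two summands, the first of which is nonzero. Hence \<open>y = 0\<close>.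
\<close>

section \<open>The monoid generated by the powers of a rational\<close>

abbreviation power_sums :: "rat \<Rightarrow> rat set"
  where "power_sums r \<equiv> carrier (power_monoid r)"

lemma power_monoid_simps [simp]:
  "x \<otimes>\<^bsub>power_monoid r\<^esub> y = x + y" "\<one>\<^bsub>power_monoid r\<^esub> = 0"
  by (simp_all add: power_monoid_def nonneg_rat_monoid_def)

context
  fixes r :: rat
  assumes r_pos: "r > 0"
begin

lemma power_sums_submonoid: "submonoid (power_sums r) nonneg_rat_monoid"
proof -
  have "{r powi n | n :: int. True} \<subseteq> carrier nonneg_rat_monoid"
    using r_pos by (auto simp: nonneg_rat_monoid_def)
  then show ?thesis
    using submonoid_generated_submonoid[OF monoid_nonneg_rat_monoid]
    by (simp add: power_monoid_def)
qed

lemma power_sums_zero: "0 \<in> power_sums r"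
  using submonoid.one_closed[OF power_sums_submonoid] by (simp add: nonneg_rat_monoid_def)

lemma power_sums_add: "x \<in> power_sums r \<Longrightarrow> y \<in> power_sums r \<Longrightarrow> x + y \<in> power_sums r"
  using submonoid.m_closed[OF power_sums_submonoid] by (simp add: nonneg_rat_monoid_def)

lemma power_sums_nonneg: "x \<in> power_sums r \<Longrightarrow> 0 \<le> x"
  using submonoid.subset[OF power_sums_submonoid] by (auto simp: nonneg_rat_monoid_def)

lemma power_sums_powi: "r powi n \<in> power_sums r"
  using submonoid_generated_superset[of "{r powi n | n :: int. True}" nonneg_rat_monoid]
  by (auto simp: power_monoid_def)

lemma power_sums_one: "1 \<in> power_sums r"
  using power_sums_powi[of 0] by simp

lemma power_sums_induct [consumes 1, case_names zero powi add]:
  assumes "x \<in> power_sums r"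
    and "P 0" and "\<And>n. P (r powi n)"
    and "\<And>x y. x \<in> power_sums r \<Longrightarrow> y \<in> power_sums r \<Longrightarrow> P x \<Longrightarrow> P y \<Longrightarrow> P (x + y)"
  shows "P x"
proof -
  let ?H = "{x \<in> power_sums r. P x}"
  have "submonoid ?H nonneg_rat_monoid"
    using assms(2,4) power_sums_zero power_sums_add power_sums_nonneg
    by (intro submonoid.intro) (auto simp: nonneg_rat_monoid_def)
  then have "power_sums r \<subseteq> ?H"
    using assms(3) power_sums_powi
      submonoid_generated_least[of ?H nonneg_rat_monoid "{r powi n | n :: int. True}"]
    by (auto simp: power_monoid_def)
  with assms(1) show ?thesis by blast
qed

lemma power_sums_split:
  assumes "x \<in> power_sums r" "x \<noteq> 0"
  obtains k y where "x = r powi k + y" "y \<in> power_sums r"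
proof -
  have "x = 0 \<or> (\<exists>k. \<exists>y \<in> power_sums r. x = r powi k + y)"
    using assms(1)
  proof (induction rule: power_sums_induct)
    case zero
    then show ?case by simp
  next
    case (powi n)
    have "r powi n = r powi n + 0" by simp
    then show ?case using power_sums_zero by blast
  next
    case (add x y)
    then show ?case by (metis add.assoc add_0 power_sums_add)
  qed
  with assms(2) that show thesis by blast
qed

lemma power_sums_scale: "x \<in> power_sums r \<Longrightarrow> r powi k * x \<in> power_sums r"
proof (induction rule: power_sums_induct)
  case zero
  then show ?case by (simp add: power_sums_zero)
next
  case (powi n)
  have "r powi k * r powi n = r powi (k + n)"
    using r_pos by (simp add: power_int_add)
  then show ?case by (simp only: power_sums_powi)
next
  case (add x y)
  then show ?case by (simp add: distrib_left power_sums_add)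
qed

end

lemma power_monoid_inverse: "power_monoid (inverse r) = power_monoid r"
proof -
  have "{inverse r powi n | n :: int. True} = {r powi n | n :: int. True}"
    by (auto simp: power_int_inverse simp flip: power_int_minus) (metis minus_minus)
  then show ?thesis by (simp add: power_monoid_def)
qed


section \<open>The atom 1\<close>

text \<open>
  An element less than \<open>1\<close> can only involve powers \<open>r\<^sup>n\<close> less than \<open>1\<close>, hence with \<open>n > 0\<close>, and each
  of these has a numerator divisible by \<open>a\<close>.
\<close>

lemma power_sums_less_one:
  fixes a b :: nat
  assumes r: "r = of_nat a / of_nat b" and ab: "0 < a" "a < b"
    and x: "x \<in> power_sums r" "x < 1"
  shows "\<exists>N z. x * of_nat (b ^ N) = of_nat (a * z)"
proof -
  have r_pos: "r > 0" and r_less: "r < 1" using r ab by auto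
  from x show ?thesis
  proof (induction rule: power_sums_induct[OF r_pos, consumes 1, case_names zero powi add])
    case zero
    then show ?case by (intro exI[of _ 0]) simp
  next
    case (powi n)
    have "n > 0"
    proof (rule ccontr)
      assume "\<not> n > 0"
      then have "r powi n = inverse r ^ nat (- n)" by (auto simp: power_int_def)
      also have "\<dots> \<ge> 1" using r_pos r_less by (intro one_le_power) (simp add: one_le_inverse)
      finally show False using powi by simp
    qed
    then obtain m where m: "n = int (Suc m)"
      by (metis gr0_implies_Suc zero_less_imp_eq_int)
    have "r powi n * of_nat (b ^ Suc m) = of_nat (a * a ^ m)"
      using ab unfolding m power_int_of_nat r by (simp add: power_divide)
    then show ?case by blast
  next
    case (add x y)
    then have "x < 1" "y < 1"
      using power_sums_nonneg[OF r_pos, of x] power_sums_nonneg[OF r_pos, of y] by linarith+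
    with add obtain N z N' z' where
      *: "x * of_nat (b ^ N) = of_nat (a * z)" "y * of_nat (b ^ N') = of_nat (a * z')"
      by blast
    have "(x + y) * of_nat (b ^ (N + N'))
        = x * of_nat (b ^ N) * of_nat (b ^ N') + y * of_nat (b ^ N') * of_nat (b ^ N)"
      by (simp add: power_add algebra_simps)
    also have "\<dots> = of_nat (a * (z * b ^ N' + z' * b ^ N))"
      unfolding * by (simp add: algebra_simps)
    finally show ?case by blast
  qed
qed

lemma one_atom_less:
  fixes a b :: nat
  assumes r: "r = of_nat a / of_nat b" and ab: "coprime a b" "1 < a" "a < b"
    and xy: "x \<in> power_sums r" "y \<in> power_sums r" "x + y = 1"
  shows "x = 0 \<or> y = 0"
proof (rule ccontr)
  assume nz: "\<not> (x = 0 \<or> y = 0)"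
  have r_pos: "r > 0" using r ab by simp
  have "x < 1" "y < 1"
    using nz xy power_sums_nonneg[OF r_pos, of x] power_sums_nonneg[OF r_pos, of y] by linarith+
  then obtain N z N' z' where
    *: "x * of_nat (b ^ N) = of_nat (a * z)" "y * of_nat (b ^ N') = of_nat (a * z')"
    using power_sums_less_one[OF r _ ab(3)] xy ab by (metis less_trans zero_less_one)
  have "(of_nat (b ^ (N + N')) :: rat) = (x + y) * of_nat (b ^ (N + N'))"
    using xy by simp
  also have "\<dots> = x * of_nat (b ^ N) * of_nat (b ^ N') + y * of_nat (b ^ N') * of_nat (b ^ N)"
    by (simp add: power_add algebra_simps)
  also have "\<dots> = of_nat (a * (z * b ^ N' + z' * b ^ N))"
    unfolding * by (simp add: algebra_simps)
  finally have "b ^ (N + N') = a * (z * b ^ N' + z' * b ^ N)"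
    by (simp only: of_nat_eq_iff)
  then have "a dvd b ^ (N + N')" by simp
  moreover have "coprime a (b ^ (N + N'))" using ab by simp
  ultimately show False using ab by (metis coprime_absorb_left is_unit_gcd nat_dvd_1_iff_1 less_irrefl)
qed

lemma one_atom:
  fixes a b :: nat
  assumes r: "r = of_nat a / of_nat b" and ab: "coprime a b" "1 < a" "1 < b"
    and xy: "x \<in> power_sums r" "y \<in> power_sums r" "x + y = 1"
  shows "x = 0 \<or> y = 0"
proof (cases "a < b")
  case True
  then show ?thesis using one_atom_less assms by blast
next
  case False
  moreover have "a \<noteq> b" using ab by auto
  ultimately have "b < a" by simp
  moreover have "inverse r = of_nat b / of_nat a" using r by simp
  ultimately show ?thesis
    using one_atom_less[of "inverse r" b a x y] ab(1,3) xy
    unfolding power_monoid_inverse by (simp only: coprime_commute)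
qed


section \<open>Automorphisms\<close>

text \<open>
  Writing \<open>x = m / n\<close>, additivity gives \<open>n f(x) = f(n x) = f(m 1) = m f(1)\<close>.
\<close>

lemma additive_on_power_sums_linear:
  fixes f :: "rat \<Rightarrow> rat"
  assumes r_pos: "r > 0"
    and zero: "f 0 = 0"
    and add: "\<And>x y. x \<in> power_sums r \<Longrightarrow> y \<in> power_sums r \<Longrightarrow> f (x + y) = f x + f y"
    and x: "x \<in> power_sums r"
  shows "f x = f 1 * x"
proof -
  have mult: "of_nat n * y \<in> power_sums r \<and> f (of_nat n * y) = of_nat n * f y"
    if "y \<in> power_sums r" for n y
    using that
    by (induction n) (auto simp: zero add distrib_right power_sums_zero[OF r_pos] power_sums_add[OF r_pos])
  obtain p q where pq: "quotient_of x = (p, q)" by fastforce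
  then have q: "q > 0" and x_eq: "x = of_int p / of_int q"
    by (auto simp: quotient_of_denom_pos quotient_of_div)
  have "p \<ge> 0"
    using power_sums_nonneg[OF r_pos x] q unfolding x_eq by (simp add: zero_le_divide_iff)
  then obtain m n where mn: "p = int m" "q = int n"
    using q by (metis nonneg_int_cases less_imp_le)
  have "n > 0" using q mn by simp
  have "of_nat n * x = of_nat m * 1" using \<open>n > 0\<close> unfolding x_eq mn by simp
  then have "of_nat n * f x = of_nat m * f 1"
    using mult[OF x, of n] mult[OF power_sums_one[OF r_pos], of m] by metis
  then show ?thesis using \<open>n > 0\<close> unfolding x_eq mn by (simp add: field_simps)
qed

text \<open>
  Restricted to the carrier because automorphisms are extensional functions.
\<close>

definition dilation :: "rat \<Rightarrow> int \<Rightarrow> rat \<Rightarrow> rat"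
  where "dilation r k = (\<lambda>x\<in>power_sums r. r powi k * x)"

lemma dilation_monoid_auto:
  assumes r_pos: "r > 0"
  shows "dilation r k \<in> monoid_auto (power_monoid r)"
proof -
  have inv: "r powi k * (r powi (- k) * x) = x" "r powi (- k) * (r powi k * x) = x" for x
    using r_pos by (simp_all add: power_int_minus)
  have "bij_betw (dilation r k) (power_sums r) (power_sums r)"
    by (rule bij_betwI[where g = "\<lambda>x. r powi (- k) * x"])
      (auto simp only: dilation_def restrict_apply' inv power_sums_scale[OF r_pos] Pi_iff)
  then show ?thesis
    by (auto simp: monoid_auto_def Bij_def hom_def dilation_def distrib_left
        power_sums_scale[OF r_pos] power_sums_add[OF r_pos] power_sums_zero[OF r_pos])
qed

lemma dilation_compose:
  assumes r_pos: "r > 0"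
  shows "compose (power_sums r) (dilation r j) (dilation r k) = dilation r (j + k)"
  using r_pos
  by (auto simp: fun_eq_iff compose_def dilation_def power_sums_scale power_int_add)

lemma monoid_auto_is_dilation:
  fixes a b :: nat
  assumes r: "r = of_nat a / of_nat b" and ab: "coprime a b" "1 < a" "1 < b"
    and f: "f \<in> monoid_auto (power_monoid r)"
  shows "\<exists>k. f = dilation r k"
proof -
  let ?M = "power_sums r"
  have r_pos: "r > 0" using r ab by simp
  have add: "f (x + y) = f x + f y" if "x \<in> ?M" "y \<in> ?M" for x y
    using f that by (auto simp: monoid_auto_def hom_def)
  have zero: "f 0 = 0" and bij: "bij_betw f ?M ?M" and ext: "f \<in> extensional ?M"
    using f by (auto simp: monoid_auto_def Bij_def)
  have inj: "f x = f y \<longleftrightarrow> x = y" if "x \<in> ?M" "y \<in> ?M" for x y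
    using bij that by (auto simp: bij_betw_def inj_on_eq_iff)
  have f1: "f 1 \<in> ?M" using bij power_sums_one[OF r_pos] by (auto simp: bij_betw_def)
  have "f 1 \<noteq> 0"
    using inj[OF power_sums_one[OF r_pos] power_sums_zero[OF r_pos]] zero by simp
  with f1 obtain k y where ky: "f 1 = r powi k + y" "y \<in> ?M"
    by (rule power_sums_split[OF r_pos])
  have "r powi k \<in> f ` ?M" "y \<in> f ` ?M"
    using bij ky power_sums_powi[OF r_pos] by (auto simp: bij_betw_def)
  then obtain u v where uv: "u \<in> ?M" "v \<in> ?M" "f u = r powi k" "f v = y" by force
  have "f (u + v) = f 1" using add uv ky by simp
  then have "u + v = 1"
    using inj uv power_sums_add[OF r_pos] power_sums_one[OF r_pos] by blast
  then have "u = 0 \<or> v = 0" using one_atom[OF r ab] uv by blast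
  moreover have "u \<noteq> 0" using uv zero r_pos by force
  ultimately have "f 1 = r powi k" using ky uv zero by simp
  then have "f x = dilation r k x" for x
    using additive_on_power_sums_linear[of r f x] r_pos zero add extensional_arb[OF ext, of x]
    by (cases "x \<in> ?M") (simp_all add: dilation_def)
  then show ?thesis by blast
qed

theorem proposition3p5:
  fixes r :: rat and a b :: nat
  assumes "r > 0"
    and "a > 0" and "b > 0" and "coprime a b" and "r = of_nat a / of_nat b"
    and "a > 1" and "b > 1"
  shows "monoid_AutGroup (power_monoid r) \<cong> integer_group"
proof -
  let ?A = "monoid_AutGroup (power_monoid r)"
  have "a \<noteq> b" using assms by auto
  then have r1: "r \<noteq> 1" using assms by simp
  have "dilation r \<in> iso integer_group ?A"
  proof (rule isoI)
    show "dilation r \<in> hom integer_group ?A"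
    proof (rule homI)
      fix j k
      have "dilation r i \<in> Bij (power_sums r)" for i
        using dilation_monoid_auto[OF assms(1)] by (simp add: monoid_auto_def)
      then show "dilation r (j \<otimes>\<^bsub>integer_group\<^esub> k) = dilation r j \<otimes>\<^bsub>?A\<^esub> dilation r k"
        by (simp add: monoid_AutGroup_def BijGroup_def dilation_compose[OF assms(1)]
            integer_group_def)
    qed (simp add: monoid_AutGroup_def dilation_monoid_auto[OF assms(1)])
    have "j = k" if "dilation r j = dilation r k" for j k
    proof -
      have "r powi j = r powi k"
        using fun_cong[OF that, of 1] power_sums_one[OF assms(1)] by (simp add: dilation_def)
      then show ?thesis
        using assms(1) r1 power_int_strict_increasing[of j k r] power_int_strict_increasing[of k j r]
          power_int_strict_decreasing[of j k r] power_int_strict_decreasing[of k j r]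
        by (cases j k rule: linorder_cases; cases r "1 :: rat" rule: linorder_cases) auto
    qed
    moreover have "range (dilation r) = monoid_auto (power_monoid r)"
      using dilation_monoid_auto[OF assms(1)]
        monoid_auto_is_dilation[OF assms(5,4,6,7)] by blast
    ultimately show "bij_betw (dilation r) (carrier integer_group) (carrier ?A)"
      by (simp add: bij_betw_def inj_def monoid_AutGroup_def)
  qed
  then show ?thesis
    using group.iso_sym[OF group_integer_group] by (auto simp: is_iso_def)
qed

end
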